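(* Let $G$ and $H$ be finite simple undirected graphs of orders $m\ge 1$ and $n\ge 1$, respectively. Then for each $\widehat\delta\in\{\widehat\delta_{(1)},\widehat\delta_1,\widehat\delta_\square\}$ the limit \[ \lim_{\ell\to\infty}\widehat\delta\big(G^{\odot \ell n},H^{\odot \ell m}\big) \] exists.
   Context: For a graph $G$ with vertex set $V$, its adjacency matrix $A_G\in\{0,1\}^{V\times V}$ has $A_G(v,v')=1$ iff $vv'$ is an edge. For a matrix $A\in\mathbb{R}^{V\times V}$ and a bijection $\pi:V\to W$, let $A^\pi\in\mathbb{R}^{W\times W}$ be given by $A^\pi(w,w')=A(\pi^{-1}(w),\pi^{-1}(w'))$. Matrix norms for $B\in\mathbb{R}^{I\times J}$: entrywise 1-norm $\|B\|_{(1)}=\sum_{i,j}|B(i,j)|$; operator 1-norm $\|B\|_1=\sup_{x\neq 0}\|Bx\|_1/\|x\|_1$ (where $\|x\|_1=\sum_j|x(j)|$); cut norm $\|B\|_\square=\max_{S\subseteq I,T\subseteq J}\big|\sum_{i\in S,j\in T}B(i,j)\big|$. For graphs $G=(V,E_G)$, $H=(W,E_H)$ of the same order $N$, and $\|\cdot\|$ one of these norms, define $\delta_{\|\cdot\|}(G,H)=\min_{\pi}\|A_G^\pi-A_H\|$, the minimum over all bijections $\pi:V\to W$; write $\delta_{(1)},\delta_1,\delta_\square$ respectively. Normalised versions: $\widehat\delta_{(1)}(G,H)=\delta_{(1)}(G,H)/N^2$, $\widehat\delta_1(G,H)=\delta_1(G,H)/N$, $\widehat\delta_\square(G,H)=\delta_\square(G,H)/N^2$.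 For a graph $G$ and $k\ge 1$, the blow-up $G^{\odot k}$ is the graph with vertex set $V_G\times[k]$ in which $(v,i)(w,j)$ is an edge iff $vw$ is an edge of $G$ (so $|G^{\odot k}|=k|G|$). Note that $G^{\odot\ell n}$ and $H^{\odot \ell m}$ both have order $\ell mn$. *)

theory Defs
  imports Complex_Main "HOL-Library.FuncSet"
begin

record 'a graph =
  verts :: "'a set"
  edges :: "'a set set"

definition simple_graph :: "'a graph \<Rightarrow> bool" where
  "simple_graph G \<longleftrightarrow> finite (verts G) \<and> (\<forall>e \<in> edges G. e \<subseteq> verts G \<and> card e = 2)"

definition graph_order :: "'a graph \<Rightarrow> nat" where
  "graph_order G = card (verts G)"

text \<open>A matrix with index sets \<open>I\<close> and \<open>J\<close> is a function of two arguments; the index sets are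
  passed separately, and values outside \<open>I \<times> J\<close> are never used.\<close>

type_synonym ('i, 'j) mat = "'i \<Rightarrow> 'j \<Rightarrow> real"

definition adj_mat :: "'a graph \<Rightarrow> ('a, 'a) mat" where
  "adj_mat G v v' = (if {v, v'} \<in> edges G then 1 else 0)"

definition permute_mat :: "'a set \<Rightarrow> ('a \<Rightarrow> 'b) \<Rightarrow> ('a, 'a) mat \<Rightarrow> ('b, 'b) mat" where
  "permute_mat V \<pi> A w w' = A (inv_into V \<pi> w) (inv_into V \<pi> w')"

definition entry_norm :: "'i set \<Rightarrow> 'j set \<Rightarrow> ('i, 'j) mat \<Rightarrow> real" where
  "entry_norm I J B = (\<Sum>i\<in>I. \<Sum>j\<in>J. \<bar>B i j\<bar>)"

definition vec_norm1 :: "'j set \<Rightarrow> ('j \<Rightarrow> real) \<Rightarrow> real" where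
  "vec_norm1 J x = (\<Sum>j\<in>J. \<bar>x j\<bar>)"

definition mat_vec :: "'j set \<Rightarrow> ('i, 'j) mat \<Rightarrow> ('j \<Rightarrow> real) \<Rightarrow> 'i \<Rightarrow> real" where
  "mat_vec J B x i = (\<Sum>j\<in>J. B i j * x j)"

definition op_norm1 :: "'i set \<Rightarrow> 'j set \<Rightarrow> ('i, 'j) mat \<Rightarrow> real" where
  "op_norm1 I J B =
     Sup {vec_norm1 I (mat_vec J B x) / vec_norm1 J x | x. \<exists>j\<in>J. x j \<noteq> 0}"

definition cut_norm :: "'i set \<Rightarrow> 'j set \<Rightarrow> ('i, 'j) mat \<Rightarrow> real" where
  "cut_norm I J B = Max ((\<lambda>(S, T). \<bar>\<Sum>i\<in>S. \<Sum>j\<in>T. B i j\<bar>) ` (Pow I \<times> Pow J))"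

text \<open>Extensional functions are used so that there are only finitely many bijections between
  two finite sets.\<close>

definition bijections :: "'a set \<Rightarrow> 'b set \<Rightarrow> ('a \<Rightarrow> 'b) set" where
  "bijections V W = {\<pi> \<in> V \<rightarrow>\<^sub>E W. bij_betw \<pi> V W}"

text \<open>Only meaningful for graphs of equal order: otherwise the minimum is over the empty set.\<close>

definition graph_dist ::
  "('b set \<Rightarrow> 'b set \<Rightarrow> ('b, 'b) mat \<Rightarrow> real) \<Rightarrow> 'a graph \<Rightarrow> 'b graph \<Rightarrow> real" where
  "graph_dist nrm G H =
     Min ((\<lambda>\<pi>. nrm (verts H) (verts H)
                  (\<lambda>w w'. permute_mat (verts G) \<pi> (adj_mat G) w w' - adj_mat H w w'))
          ` bijections (verts G) (verts H))"

definition ndist_entry :: "'a graph \<Rightarrow> 'b graph \<Rightarrow> real" where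
  "ndist_entry G H = graph_dist entry_norm G H / real (graph_order G) ^ 2"

definition ndist_op :: "'a graph \<Rightarrow> 'b graph \<Rightarrow> real" where
  "ndist_op G H = graph_dist op_norm1 G H / real (graph_order G)"

definition ndist_cut :: "'a graph \<Rightarrow> 'b graph \<Rightarrow> real" where
  "ndist_cut G H = graph_dist cut_norm G H / real (graph_order G) ^ 2"

definition blow_up :: "'a graph \<Rightarrow> nat \<Rightarrow> ('a \<times> nat) graph" where
  "blow_up G k = \<lparr> verts = verts G \<times> {1..k},
     edges = {{(v, i), (w, j)} | v w i j. {v, w} \<in> edges G \<and> i \<in> {1..k} \<and> j \<in> {1..k}} \<rparr>"

end

(* For each norm the entry of the difference matrix at a pair of vertices depends only on their types,
   the pairs (base vertex of G, base vertex of H) matched by the bijection. Given an optimal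
   bijection at level l, Hall's theorem gives a level-one bijection using only types that
   already occur. Stacking q copies of the former and r copies of the latter gives a bijection at level
   ql + r whose normalised norm exceeds that at level l by at most 1 - (ql/(ql+r))^d, where d is
   the exponent of the normalisation. Hence the sequence converges to its infimum. *)

theory Submission
  imports Defs
begin

subsection \<open>Hall's marriage theorem\<close>

text \<open>The obstacle is the operator norm, a maximum of column sums: a single added vertex of a
  new type may bring a column whose sum over the \<open>q\<close> old copies is far above
  \<open>q\<close> times the old maximum, and a maximum does not average it away. A column whose
  type already occurs has at most \<open>q\<close> times the old maximum on the old rows, plus at
  most 1 for each added row. Hall's condition holds because an overlay of level \<open>l\<close>
  meets all base vertices of \<open>G\<close> equally often, and likewise those of \<open>H\<close>:
  counting the pairs over a set and over its neighbours compares the two sizes, and the factor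
  \<open>l\<close> cancels. The remainder \<open>r\<close> is taken below \<open>l\<close>, so for
  fixed \<open>l\<close> the error vanishes as the level grows.\<close>

lemma hall_marriage:
  assumes "finite I" and "\<And>i. i \<in> I \<Longrightarrow> finite (A i)"
    and "\<And>J. J \<subseteq> I \<Longrightarrow> card J \<le> card (\<Union>(A ` J))"
  shows "\<exists>f. inj_on f I \<and> (\<forall>i\<in>I. f i \<in> A i)"
  using assms
proof (induction "card I" arbitrary: I A rule: less_induct)
  case less
  note fin = less.prems(1) and finA = less.prems(2) and hall = less.prems(3)
  show ?case
  \<comment> \<open>The dichotomy of Halmos and Vaughan. If a nonempty proper subfamily
    \<open>J\<close> is tight, \<open>J\<close> and \<open>I - J\<close> are matched separately, the
    latter avoiding all values available to \<open>J\<close>. Otherwise every such subfamily has a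
    spare value, so one index can be matched arbitrarily and its value deleted.\<close>
  proof (cases "\<exists>J. J \<subset> I \<and> J \<noteq> {} \<and> card (\<Union>(A ` J)) = card J")
    case True
    then obtain J where J: "J \<subset> I" "J \<noteq> {}" and tight: "card (\<Union>(A ` J)) = card J" by blast
    let ?U = "\<Union>(A ` J)"
    have finJ: "finite J" using J fin by (meson finite_subset psubset_imp_subset)
    have finU: "finite ?U" using finJ finA J by blast
    have "\<exists>f. inj_on f J \<and> (\<forall>i\<in>J. f i \<in> A i)"
    proof (rule less.hyps)
      show "card J < card I" using J fin by (simp add: psubset_card_mono)
    qed (use J finJ finA hall in auto)
    then obtain f where f: "inj_on f J" "\<forall>i\<in>J. f i \<in> A i" by blast
    have "\<exists>g. inj_on g (I - J) \<and> (\<forall>i\<in>I - J. g i \<in> A i - ?U)"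
    proof (rule less.hyps)
      show "card (I - J) < card I"
        using J fin by (intro psubset_card_mono) auto
    next
      fix L assume L: "L \<subseteq> I - J"
      have finL: "finite L" using L fin by (meson finite_Diff finite_subset)
      \<comment> \<open>Hall's condition survives the removal of \<open>?U\<close>: it is applied to
        \<open>L \<union> J\<close>, and by tightness the removal costs exactly
        \<open>card J\<close>.\<close>
      have "\<Union>((\<lambda>i. A i - ?U) ` L) = \<Union>(A ` (L \<union> J)) - ?U" by blast
      moreover have "card (\<dots>) = card (\<Union>(A ` (L \<union> J))) - card ?U"
        by (rule card_Diff_subset) (use finU in auto)
      moreover have "card (L \<union> J) \<le> card (\<Union>(A ` (L \<union> J)))"
        by (rule hall) (use L J in auto)
      moreover have "card (L \<union> J) = card L + card J"
        using L finL finJ by (intro card_Un_disjoint) auto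
      ultimately show "card L \<le> card (\<Union>((\<lambda>i. A i - ?U) ` L))" using tight by simp
    qed (use fin finA in auto)
    then obtain g where g: "inj_on g (I - J)" "\<forall>i\<in>I - J. g i \<in> A i - ?U" by blast
    let ?h = "\<lambda>i. if i \<in> J then f i else g i"
    have "inj_on ?h I"
    proof (rule inj_onI)
      fix x y assume xy: "x \<in> I" "y \<in> I" "?h x = ?h y"
      have "f a \<noteq> g b" if "a \<in> J" "b \<in> I - J" for a b
        using bspec[OF f(2) that(1)] bspec[OF g(2) that(2)] that(1) by auto
      from this[of x y] this[of y x] show "x = y"
        using xy inj_onD[OF f(1), of x y] inj_onD[OF g(1), of x y]
        by (cases "x \<in> J"; cases "y \<in> J") auto
    qed
    moreover have "\<forall>i\<in>I. ?h i \<in> A i" using f g by auto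
    ultimately show ?thesis by blast
  next
    case slack: False
    show ?thesis
    proof (cases "I = {}")
      case False
      then obtain i where i: "i \<in> I" by blast
      have "card {i} \<le> card (A i)" using hall[of "{i}"] i by simp
      then obtain x where x: "x \<in> A i" by fastforce
      have "\<exists>f. inj_on f (I - {i}) \<and> (\<forall>j\<in>I - {i}. f j \<in> A j - {x})"
      proof (rule less.hyps)
        show "card (I - {i}) < card I" by (rule card_Diff1_less[OF fin i])
      next
        fix L assume L: "L \<subseteq> I - {i}"
        show "card L \<le> card (\<Union>((\<lambda>j. A j - {x}) ` L))"
        proof (cases "L = {}")
          case False
          \<comment> \<open>\<open>L\<close> is nonempty and proper, hence not tight; its spare
            value pays for the loss of \<open>x\<close>.\<close>
          have "L \<subset> I" using L i by blast
          then have "card L < card (\<Union>(A ` L))"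
            using slack False hall[of L] by (metis le_neq_implies_less psubset_imp_subset)
          moreover have "card (\<Union>(A ` L)) - 1 \<le> card (\<Union>(A ` L) - {x})"
            by (simp add: card_Diff_singleton_if)
          moreover have "\<Union>((\<lambda>j. A j - {x}) ` L) = \<Union>(A ` L) - {x}" by blast
          ultimately show ?thesis by simp
        qed simp
      qed (use fin finA in auto)
      then obtain f where f: "inj_on f (I - {i})" "\<forall>j\<in>I - {i}. f j \<in> A j - {x}" by blast
      have "inj_on (f(i := x)) I"
      proof (rule inj_onI)
        fix y z assume yz: "y \<in> I" "z \<in> I" "(f(i := x)) y = (f(i := x)) z"
        show "y = z"
          using yz f by (cases "y = i"; cases "z = i") (auto dest: inj_onD)
      qed
      moreover have "\<forall>j\<in>I. (f(i := x)) j \<in> A j" using f x by auto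
      ultimately show ?thesis by blast
    qed simp
  qed
qed

subsection \<open>Overlays\<close>

text \<open>A bijection between the blow-ups with vertex sets \<open>V \<times> {1..a}\<close> and \<open>W \<times> {1..b}\<close> matters
  only through the pairs of base vertices that it matches. These pairs form an overlay.\<close>

definition overlay :: "'a set \<Rightarrow> 'b set \<Rightarrow> nat \<Rightarrow> nat \<Rightarrow> 'p set \<Rightarrow> ('p \<Rightarrow> 'a \<times> 'b) \<Rightarrow> bool" where
  "overlay V W a b P \<tau> \<longleftrightarrow> finite P \<and> \<tau> \<in> P \<rightarrow> V \<times> W \<and>
     (\<forall>v\<in>V. card {p\<in>P. fst (\<tau> p) = v} = a) \<and> (\<forall>w\<in>W. card {p\<in>P. snd (\<tau> p) = w} = b)"

lemma card_fibres:
  assumes "finite P" and "finite S" and "\<And>s. s \<in> S \<Longrightarrow> card {p\<in>P. f p = s} = k"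
  shows "card {p\<in>P. f p \<in> S} = card S * k"
proof -
  have "{p\<in>P. f p \<in> S} = (\<Union>s\<in>S. {p\<in>P. f p = s})" by blast
  also have "card \<dots> = (\<Sum>s\<in>S. card {p\<in>P. f p = s})"
    using assms by (intro card_UN_disjoint) auto
  finally show ?thesis using assms by simp
qed

text \<open>Numbering the elements inside each fibre supplies the copy index that an overlay
  forgets. Applied to both projections, this turns an overlay back into a bijection of
  blow-ups.\<close>

lemma bij_betw_fibres:
  assumes "finite P" and "f \<in> P \<rightarrow> V" and "\<And>v. v \<in> V \<Longrightarrow> card {p\<in>P. f p = v} = k"
  obtains g where "bij_betw g P (V \<times> {1..k})" and "\<And>p. p \<in> P \<Longrightarrow> fst (g p) = f p"
proof -
  have "\<exists>e. bij_betw e {p\<in>P. f p = v} {1..k}" if "v \<in> V" for v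
    using assms that by (intro finite_same_card_bij) auto
  then obtain e where e: "\<And>v. v \<in> V \<Longrightarrow> bij_betw (e v) {p\<in>P. f p = v} {1..k}" by metis
  let ?g = "\<lambda>p. (f p, e (f p) p)"
  have "bij_betw ?g P (V \<times> {1..k})"
  proof (rule bij_betw_imageI)
    show "inj_on ?g P"
    proof (rule inj_onI)
      fix x y assume xy: "x \<in> P" "y \<in> P" "?g x = ?g y"
      with assms(2) have "inj_on (e (f x)) {p\<in>P. f p = f x}" using e[of "f x"] 
        by (auto simp: bij_betw_def)
      with xy show "x = y" by (auto dest: inj_onD)
    qed
    show "?g ` P = V \<times> {1..k}"
    proof
      show "?g ` P \<subseteq> V \<times> {1..k}"
      proof
        fix z assume "z \<in> ?g ` P"
        then obtain p where p: "p \<in> P" "z = ?g p" by blast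
        with assms(2) have "f p \<in> V" by auto
        from bij_betw_apply[OF e[OF this], of p] p show "z \<in> V \<times> {1..k}"
          using \<open>f p \<in> V\<close> by auto
      qed
      show "V \<times> {1..k} \<subseteq> ?g ` P"
      proof
        fix z assume "z \<in> V \<times> {1..k}"
        then obtain v i where z: "z = (v, i)" "v \<in> V" "i \<in> {1..k}" by blast
        then obtain p where "p \<in> P" "f p = v" "i = e v p"
          using e[of v] by (auto simp: bij_betw_def image_iff set_eq_iff)
        with z show "z \<in> ?g ` P" by auto
      qed
    qed
  qed
  then show thesis using that by simp
qed

text \<open>Since \<open>\<pi>\<close> is injective, the pairs over \<open>w\<close> can be counted
  through their images, which are the \<open>b\<close> copies of \<open>w\<close>. Besides optimal
  bijections, the matching found by Hall's theorem is read as an overlay in this way.\<close>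

lemma overlay_of_bij:
  assumes "finite V" and "finite W" and bij: "bij_betw \<pi> (V \<times> {1..a}) (W \<times> {1..b})"
  shows "overlay V W a b (V \<times> {1..a}) (\<lambda>p. (fst p, fst (\<pi> p)))"
proof -
  have "card {p \<in> V \<times> {1..a}. fst p = v} = a" if "v \<in> V" for v
  proof -
    have "{p \<in> V \<times> {1..a}. fst p = v} = {v} \<times> {1..a}" using that by auto
    then show ?thesis by simp
  qed
  moreover have "card {p \<in> V \<times> {1..a}. fst (\<pi> p) = w} = b" if "w \<in> W" for w
  proof -
    have "\<pi> ` {p \<in> V \<times> {1..a}. fst (\<pi> p) = w} = {q \<in> \<pi> ` (V \<times> {1..a}). fst q = w}" by blast
    also have "\<dots> = {w} \<times> {1..b}" using bij that by (auto simp: bij_betw_def)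
    finally have "\<pi> ` {p \<in> V \<times> {1..a}. fst (\<pi> p) = w} = {w} \<times> {1..b}" .
    moreover have "inj_on \<pi> {p \<in> V \<times> {1..a}. fst (\<pi> p) = w}"
      using bij by (auto simp: bij_betw_def intro: inj_on_subset)
    ultimately show ?thesis using card_image by fastforce
  qed
  moreover have "fst (\<pi> p) \<in> W" if "p \<in> V \<times> {1..a}" for p
    using bij_betw_apply[OF bij that] by auto
  ultimately show ?thesis using assms by (auto simp: overlay_def)
qed

text \<open>The integrality step: a fractional overlay of order one can be rounded to an integral one
  without leaving its support.\<close>

lemma overlay_round:
  assumes ov: "overlay V W (l * card W) (l * card V) P \<tau>" and "l \<ge> 1"
    and fin: "finite V" "finite W"
  obtains \<rho> where "overlay V W (card W) (card V) (V \<times> {1..card W}) \<rho>"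
    and "\<rho> ` (V \<times> {1..card W}) \<subseteq> \<tau> ` P"
proof -
  let ?I = "V \<times> {1..card W}"
  \<comment> \<open>Neighbours in the bipartite graph of occurring types. A slot
    \<open>(v, i)\<close> may be matched with any copy of a \<open>w\<close> such that
    \<open>(v, w)\<close> occurs.\<close>
  let ?N = "\<lambda>S. {w\<in>W. \<exists>v\<in>S. (v, w) \<in> \<tau> ` P}"
  let ?A = "\<lambda>(v, i::nat). ?N {v} \<times> {1..card V}"
  have finP: "finite P" and type: "\<And>p. p \<in> P \<Longrightarrow> \<tau> p \<in> V \<times> W"
    using ov by (auto simp: overlay_def)
  have "\<exists>f. inj_on f ?I \<and> (\<forall>p\<in>?I. f p \<in> ?A p)"
  proof (rule hall_marriage)
    fix J assume J: "J \<subseteq> ?I"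
    let ?S = "fst ` J"
    have S: "?S \<subseteq> V" using J by auto
    then have "finite ?S" using fin finite_subset by blast
    \<comment> \<open>Double counting: every element of \<open>P\<close> over \<open>?S\<close> lies
      over \<open>?N ?S\<close>, and all fibres on one side have equal size. The copy indices in
      \<open>J\<close> only help, as \<open>J\<close> is contained in the full block over
      \<open>?S\<close>.\<close>
    have "{p\<in>P. fst (\<tau> p) \<in> ?S} \<subseteq> {p\<in>P. snd (\<tau> p) \<in> ?N ?S}"
    proof
      fix p assume "p \<in> {p\<in>P. fst (\<tau> p) \<in> ?S}"
      then have p: "p \<in> P" "fst (\<tau> p) \<in> ?S" by auto
      have "(fst (\<tau> p), snd (\<tau> p)) \<in> \<tau> ` P" using p by simp
      moreover have "snd (\<tau> p) \<in> W" using type[OF p(1)] by auto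
      ultimately show "p \<in> {p\<in>P. snd (\<tau> p) \<in> ?N ?S}" using p by blast
    qed
    then have "card {p\<in>P. fst (\<tau> p) \<in> ?S} \<le> card {p\<in>P. snd (\<tau> p) \<in> ?N ?S}"
      using finP by (intro card_mono) auto
    moreover have "card {p\<in>P. fst (\<tau> p) \<in> ?S} = card ?S * (l * card W)"
      using ov S \<open>finite ?S\<close> finP by (intro card_fibres) (auto simp: overlay_def)
    moreover have "card {p\<in>P. snd (\<tau> p) \<in> ?N ?S} = card (?N ?S) * (l * card V)"
      using ov fin finP by (intro card_fibres) (auto simp: overlay_def)
    ultimately have "l * (card ?S * card W) \<le> l * (card (?N ?S) * card V)"
      by (simp add: mult.left_commute)
    then have "card ?S * card W \<le> card (?N ?S) * card V" using \<open>l \<ge> 1\<close> by simp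
    moreover have "J \<subseteq> ?S \<times> {1..card W}" using J by force
    then have "card J \<le> card ?S * card W"
      using card_mono[of "?S \<times> {1..card W}" J] \<open>finite ?S\<close> by (simp add: card_cartesian_product)
    moreover have "\<Union>(?A ` J) = ?N ?S \<times> {1..card V}" by force
    ultimately show "card J \<le> card (\<Union>(?A ` J))" by (simp add: card_cartesian_product)
  qed (use fin in auto)
  then obtain f where f: "inj_on f ?I" "\<And>p. p \<in> ?I \<Longrightarrow> f p \<in> ?A p" by blast
  have "f ` ?I \<subseteq> W \<times> {1..card V}" using f(2) by fastforce
  \<comment> \<open>Both sides have \<open>card V * card W\<close> elements, so the injection is
    onto.\<close>
  then have "f ` ?I = W \<times> {1..card V}"
    using f(1) fin by (intro card_subset_eq) (auto simp: card_image card_cartesian_product)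
  then have "bij_betw f ?I (W \<times> {1..card V})" using f(1) by (simp add: bij_betw_def)
  from overlay_of_bij[OF fin this]
  have "overlay V W (card W) (card V) ?I (\<lambda>p. (fst p, fst (f p)))" .
  moreover have "(\<lambda>p. (fst p, fst (f p))) ` ?I \<subseteq> \<tau> ` P"
    using f(2) by fastforce
  ultimately show thesis using that by blast
qed

section \<open>Stacking copies of two overlays\<close>

abbreviation copies :: "'p set \<Rightarrow> nat \<Rightarrow> 'q set \<Rightarrow> nat \<Rightarrow> ('p \<times> nat + 'q \<times> nat) set" where
  "copies P q Q r \<equiv> (P \<times> {..<q}) <+> (Q \<times> {..<r})"

abbreviation copies_type :: "('p \<Rightarrow> 't) \<Rightarrow> ('q \<Rightarrow> 't) \<Rightarrow> 'p \<times> nat + 'q \<times> nat \<Rightarrow> 't" where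
  "copies_type \<tau> \<rho> \<equiv> case_sum (\<tau> \<circ> fst) (\<rho> \<circ> fst)"

lemma card_copies:
  assumes "finite P" and "finite Q"
  shows "card (copies P q Q r) = q * card P + r * card Q"
  using assms by (simp add: card_Plus card_cartesian_product)

text \<open>Fibre sizes add over disjoint copies. With fibre sizes of level \<open>l\<close> for
  \<open>P\<close> and of level 1 for \<open>Q\<close>, the result has level
  \<open>q * l + r\<close>.\<close>

lemma overlay_copies:
  assumes P: "overlay V W a b P \<tau>" and Q: "overlay V W c d Q \<rho>"
  shows "overlay V W (q * a + r * c) (q * b + r * d) (copies P q Q r) (copies_type \<tau> \<rho>)"
proof -
  \<comment> \<open>An arbitrary predicate \<open>R\<close> on types lets one count serve both
    projections.\<close>
  have card: "card {x \<in> copies P q Q r. R (copies_type \<tau> \<rho> x)}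
      = q * card {p\<in>P. R (\<tau> p)} + r * card {p\<in>Q. R (\<rho> p)}" for R
  proof -
    have "{x \<in> copies P q Q r. R (copies_type \<tau> \<rho> x)}
          = copies {p\<in>P. R (\<tau> p)} q {p\<in>Q. R (\<rho> p)} r" by auto
    then show ?thesis using P Q by (simp add: card_copies overlay_def)
  qed
  have "copies_type \<tau> \<rho> \<in> copies P q Q r \<rightarrow> V \<times> W"
    using P Q by (fastforce simp: overlay_def Pi_iff)
  with P Q card[of "\<lambda>s. fst s = v" for v] card[of "\<lambda>s. snd s = w" for w] show ?thesis
    by (simp add: overlay_def)
qed

subsection \<open>The three norms\<close>

text \<open>The two arguments stand for one norm at two types, since a norm passed as a variable is
  monomorphic. With equal types and \<open>h = id\<close> this becomes a congruence rule: the norm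
  depends only on the entries inside \<open>P \<times> P\<close>.\<close>

definition reindexable ::
  "('j set \<Rightarrow> 'j set \<Rightarrow> ('j, 'j) mat \<Rightarrow> real) \<Rightarrow> ('p set \<Rightarrow> 'p set \<Rightarrow> ('p, 'p) mat \<Rightarrow> real) \<Rightarrow> bool" where
  "reindexable nJ nP \<longleftrightarrow>
     (\<forall>h P J B B'. finite P \<longrightarrow> P \<noteq> {} \<longrightarrow> bij_betw h P J \<longrightarrow>
        (\<forall>x\<in>P. \<forall>y\<in>P. B' x y = B (h x) (h y)) \<longrightarrow> nJ J J B = nP P P B')"

text \<open>The exponent \<open>d\<close> is the order of growth of the norm. The error term does not see the
  entries of the added rows and columns, only their number.\<close>

definition copies_bounded :: "'t itself \<Rightarrow> nat \<Rightarrow> ('p set \<Rightarrow> 'p set \<Rightarrow> ('p, 'p) mat \<Rightarrow> real) \<Rightarrow>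
    (('p \<times> nat + 'q \<times> nat) set \<Rightarrow> ('p \<times> nat + 'q \<times> nat) set \<Rightarrow>
      ('p \<times> nat + 'q \<times> nat, 'p \<times> nat + 'q \<times> nat) mat \<Rightarrow> real) \<Rightarrow> bool" where
  "copies_bounded _ d nP nX \<longleftrightarrow>
     (\<forall>P Q \<tau> \<rho> (K :: ('t, 't) mat) q r. finite P \<longrightarrow> finite Q \<longrightarrow> P \<noteq> {} \<longrightarrow> copies P q Q r \<noteq> {} \<longrightarrow>
        \<rho> ` Q \<subseteq> \<tau> ` P \<longrightarrow> (\<forall>s t. \<bar>K s t\<bar> \<le> 1) \<longrightarrow>
        nX (copies P q Q r) (copies P q Q r)
          (\<lambda>x y. K (copies_type \<tau> \<rho> x) (copies_type \<tau> \<rho> y))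
        \<le> real q ^ d * nP P P (\<lambda>x y. K (\<tau> x) (\<tau> y))
          + real (q * card P + r * card Q) ^ d - real (q * card P) ^ d)"

section \<open>Invariance of the norms under relabelling\<close>

lemma reindexable_entry: "reindexable (entry_norm :: 'j set \<Rightarrow> _) (entry_norm :: 'p set \<Rightarrow> _)"
  unfolding reindexable_def
proof (intro allI impI)
  fix h :: "'p \<Rightarrow> 'j" and P J and B :: "('j, 'j) mat" and B' :: "('p, 'p) mat"
  assume h: "bij_betw h P J" and B': "\<forall>x\<in>P. \<forall>y\<in>P. B' x y = B (h x) (h y)"
  have "entry_norm J J B = (\<Sum>x\<in>P. \<Sum>y\<in>P. \<bar>B (h x) (h y)\<bar>)"
    unfolding entry_norm_def by (simp add: sum.reindex_bij_betw[OF h, symmetric])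
  also have "\<dots> = entry_norm P P B'" unfolding entry_norm_def using B' by simp
  finally show "entry_norm J J B = entry_norm P P B'" .
qed

lemma cut_norm_ge:
  assumes "finite I" "finite J" "S \<subseteq> I" "T \<subseteq> J"
  shows "\<bar>\<Sum>i\<in>S. \<Sum>j\<in>T. B i j\<bar> \<le> cut_norm I J B"
  unfolding cut_norm_def using assms by (intro Max_ge) auto

lemma cut_norm_le:
  assumes "finite I" "finite J"
    and "\<And>S T. S \<subseteq> I \<Longrightarrow> T \<subseteq> J \<Longrightarrow> \<bar>\<Sum>i\<in>S. \<Sum>j\<in>T. B i j\<bar> \<le> c"
  shows "cut_norm I J B \<le> c"
  unfolding cut_norm_def using assms by (intro Max.boundedI) auto

lemma reindexable_cut: "reindexable (cut_norm :: 'j set \<Rightarrow> _) (cut_norm :: 'p set \<Rightarrow> _)"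
  unfolding reindexable_def
proof (intro allI impI)
  fix h :: "'p \<Rightarrow> 'j" and P J and B :: "('j, 'j) mat" and B' :: "('p, 'p) mat"
  assume fin: "finite P" and h: "bij_betw h P J"
    and B': "\<forall>x\<in>P. \<forall>y\<in>P. B' x y = B (h x) (h y)"
  have J: "J = h ` P" "finite J" using h fin by (auto simp: bij_betw_def)
  have eq: "(\<Sum>i\<in>h ` S. \<Sum>j\<in>h ` T. B i j) = (\<Sum>i\<in>S. \<Sum>j\<in>T. B' i j)"
    if "S \<subseteq> P" "T \<subseteq> P" for S T
  proof -
    have "inj_on h S" "inj_on h T" using h that by (auto simp: bij_betw_def intro: inj_on_subset)
    then have "(\<Sum>i\<in>h ` S. \<Sum>j\<in>h ` T. B i j) = (\<Sum>i\<in>S. \<Sum>j\<in>T. B (h i) (h j))"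
      by (simp add: sum.reindex)
    also have "\<dots> = (\<Sum>i\<in>S. \<Sum>j\<in>T. B' i j)"
      using B' that by (intro sum.cong) (auto simp: subset_iff)
    finally show ?thesis .
  qed
  show "cut_norm J J B = cut_norm P P B'"
  proof (rule antisym)
    show "cut_norm J J B \<le> cut_norm P P B'"
    proof (rule cut_norm_le)
      fix S T assume "S \<subseteq> J" "T \<subseteq> J"
      then obtain S' T' where "S' \<subseteq> P" "S = h ` S'" "T' \<subseteq> P" "T = h ` T'"
        unfolding J(1) by (meson subset_imageE)
      then show "\<bar>\<Sum>i\<in>S. \<Sum>j\<in>T. B i j\<bar> \<le> cut_norm P P B'"
        using eq[of S' T'] cut_norm_ge[OF fin fin] by simp
    qed (use J in auto)
    show "cut_norm P P B' \<le> cut_norm J J B"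
    proof (rule cut_norm_le)
      fix S T assume "S \<subseteq> P" "T \<subseteq> P"
      then show "\<bar>\<Sum>i\<in>S. \<Sum>j\<in>T. B' i j\<bar> \<le> cut_norm J J B"
        using eq[of S T, symmetric] cut_norm_ge[OF J(2,2), of "h ` S" "h ` T" B]
        by (simp add: J(1) image_mono)
    qed (use fin in auto)
  qed
qed

text \<open>The unit vector of a heaviest column attains the maximum, and the triangle inequality
  bounds every other quotient by a weighted mean of column sums.\<close>

lemma op_norm1_eq_Max:
  assumes "finite I" "finite J" "J \<noteq> {}"
  shows "op_norm1 I J B = Max ((\<lambda>j. \<Sum>i\<in>I. \<bar>B i j\<bar>) ` J)" (is "_ = ?M")
  unfolding op_norm1_def
proof (rule cSup_eq_maximum)
  have "?M \<in> (\<lambda>j. \<Sum>i\<in>I. \<bar>B i j\<bar>) ` J" using assms by (intro Max_in) auto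
  then obtain k where k: "k \<in> J" "?M = (\<Sum>i\<in>I. \<bar>B i k\<bar>)" by blast
  let ?e = "\<lambda>j. if j = k then 1 else 0 :: real"
  have "vec_norm1 I (mat_vec J B ?e) = ?M" "vec_norm1 J ?e = 1"
    using k assms by (simp_all add: vec_norm1_def mat_vec_def if_distrib[of "\<lambda>x. _ * x"]
        if_distrib[of abs] sum.delta cong: if_cong)
  then have "?M = vec_norm1 I (mat_vec J B ?e) / vec_norm1 J ?e" by simp
  moreover have "\<exists>j\<in>J. ?e j \<noteq> 0" using k by auto
  ultimately show "?M \<in> {vec_norm1 I (mat_vec J B x) / vec_norm1 J x | x. \<exists>j\<in>J. x j \<noteq> 0}"
    by blast
next
  fix y assume "y \<in> {vec_norm1 I (mat_vec J B x) / vec_norm1 J x | x. \<exists>j\<in>J. x j \<noteq> 0}"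
  then obtain x j where y: "y = vec_norm1 I (mat_vec J B x) / vec_norm1 J x"
    and j: "j \<in> J" "x j \<noteq> 0" by blast
  have "vec_norm1 J x > 0"
    unfolding vec_norm1_def using j assms by (intro sum_pos2[of J j]) auto
  moreover have "vec_norm1 I (mat_vec J B x) \<le> ?M * vec_norm1 J x"
  proof -
    have "vec_norm1 I (mat_vec J B x) \<le> (\<Sum>i\<in>I. \<Sum>j\<in>J. \<bar>B i j\<bar> * \<bar>x j\<bar>)"
      unfolding vec_norm1_def mat_vec_def abs_mult[symmetric] by (intro sum_mono sum_abs)
    also have "\<dots> = (\<Sum>j\<in>J. (\<Sum>i\<in>I. \<bar>B i j\<bar>) * \<bar>x j\<bar>)"
      by (subst sum.swap) (simp add: sum_distrib_right)
    also have "\<dots> \<le> (\<Sum>j\<in>J. ?M * \<bar>x j\<bar>)"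
      using assms by (intro sum_mono mult_right_mono Max_ge) auto
    finally show ?thesis by (simp add: vec_norm1_def sum_distrib_left)
  qed
  ultimately show "y \<le> ?M" by (simp add: y divide_le_eq)
qed

lemma reindexable_op: "reindexable (op_norm1 :: 'j set \<Rightarrow> _) (op_norm1 :: 'p set \<Rightarrow> _)"
  unfolding reindexable_def
proof (intro allI impI)
  fix h :: "'p \<Rightarrow> 'j" and P J and B :: "('j, 'j) mat" and B' :: "('p, 'p) mat"
  assume fin: "finite P" "P \<noteq> {}" and h: "bij_betw h P J"
    and B': "\<forall>x\<in>P. \<forall>y\<in>P. B' x y = B (h x) (h y)"
  have J: "J = h ` P" "finite J" "J \<noteq> {}" using h fin by (auto simp: bij_betw_def)
  have "(\<Sum>i\<in>J. \<bar>B i (h y)\<bar>) = (\<Sum>x\<in>P. \<bar>B' x y\<bar>)" if "y \<in> P" for y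
    using B' that by (simp add: sum.reindex_bij_betw[OF h, symmetric])
  then have "(\<lambda>j. \<Sum>i\<in>J. \<bar>B i j\<bar>) ` J = (\<lambda>y. \<Sum>x\<in>P. \<bar>B' x y\<bar>) ` P"
    by (auto simp: J(1) image_image)
  then show "op_norm1 J J B = op_norm1 P P B'"
    using fin J by (simp add: op_norm1_eq_Max)
qed

section \<open>Growth of the norms under stacking\<close>

lemma sum_copies:
  fixes g :: "'p \<times> nat + 'q \<times> nat \<Rightarrow> real"
  assumes "finite P" "finite Q"
  shows "(\<Sum>x\<in>copies P q Q r. g x)
    = (\<Sum>i<q. \<Sum>p\<in>P. g (Inl (p, i))) + (\<Sum>i<r. \<Sum>p\<in>Q. g (Inr (p, i)))"
proof -
  have "(\<Sum>x\<in>copies P q Q r. g x)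
      = (\<Sum>x\<in>P \<times> {..<q}. g (Inl x)) + (\<Sum>x\<in>Q \<times> {..<r}. g (Inr x))"
    using assms by (simp add: sum.Plus comp_def)
  also have "(\<Sum>x\<in>P \<times> {..<q}. g (Inl x)) = (\<Sum>i<q. \<Sum>p\<in>P. g (Inl (p, i)))"
    by (subst sum.swap) (simp add: sum.cartesian_product)
  also have "(\<Sum>x\<in>Q \<times> {..<r}. g (Inr x)) = (\<Sum>i<r. \<Sum>p\<in>Q. g (Inr (p, i)))"
    by (subst sum.swap) (simp add: sum.cartesian_product)
  finally show ?thesis .
qed

lemma abs_sum_le:
  fixes f :: "'i \<Rightarrow> real"
  assumes "\<And>i. i \<in> A \<Longrightarrow> \<bar>f i\<bar> \<le> c"
  shows "\<bar>\<Sum>i\<in>A. f i\<bar> \<le> real (card A) * c"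
  by (rule order_trans[OF sum_abs sum_bounded_above]) (rule assms)

text \<open>The \<open>q ^ 2\<close> blocks between copies of \<open>P\<close> cost \<open>c\<close>
  each, and every remaining entry costs at most 1. The array \<open>g\<close> may differ from block
  to block, because a cut may select different vertices in different copies.\<close>

lemma double_sum_copies_le:
  fixes g :: "'p \<times> nat + 'q \<times> nat \<Rightarrow> 'p \<times> nat + 'q \<times> nat \<Rightarrow> real"
  assumes fin: "finite P" "finite Q" and g: "\<And>x y. \<bar>g x y\<bar> \<le> 1"
    and c: "\<And>i j. \<bar>\<Sum>x\<in>P. \<Sum>y\<in>P. g (Inl (x, i)) (Inl (y, j))\<bar> \<le> c"
  shows "\<bar>\<Sum>x\<in>copies P q Q r. \<Sum>y\<in>copies P q Q r. g x y\<bar>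
    \<le> real q ^ 2 * c + real (q * card P + r * card Q) ^ 2 - real (q * card P) ^ 2"
proof -
  let ?X = "copies P q Q r"
  let ?a = "real (q * card P)" and ?b = "real (r * card Q)"
  \<comment> \<open>Only the rows from \<open>P\<close> are split by column; the rows from
    \<open>Q\<close> stay whole. The remaining entries then number
    \<open>?a * ?b + ?b * (?a + ?b)\<close>, which is \<open>(?a + ?b) ^ 2 - ?a ^ 2\<close>.\<close>
  let ?PP = "\<Sum>i<q. \<Sum>j<q. \<Sum>x\<in>P. \<Sum>y\<in>P. g (Inl (x, i)) (Inl (y, j))"
  let ?PQ = "\<Sum>i<q. \<Sum>x\<in>P. \<Sum>j<r. \<Sum>y\<in>Q. g (Inl (x, i)) (Inr (y, j))"
  let ?Q = "\<Sum>i<r. \<Sum>x\<in>Q. \<Sum>y\<in>?X. g (Inr (x, i)) y"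
  have "(\<Sum>x\<in>?X. \<Sum>y\<in>?X. g x y)
      = (\<Sum>i<q. \<Sum>x\<in>P. (\<Sum>j<q. \<Sum>y\<in>P. g (Inl (x, i)) (Inl (y, j)))
          + (\<Sum>j<r. \<Sum>y\<in>Q. g (Inl (x, i)) (Inr (y, j)))) + ?Q"
    by (subst sum_copies[OF fin, of _ q r]) (simp only: sum_copies[OF fin])
  also have "\<dots> = ?PP + ?PQ + ?Q"
    by (simp add: sum.distrib sum.swap[of _ "{..<q}" P])
  finally have eq: "(\<Sum>x\<in>?X. \<Sum>y\<in>?X. g x y) = ?PP + ?PQ + ?Q" .
  have "\<bar>?PP\<bar> \<le> real (card {..<q}) * (real (card {..<q}) * c)"
    by (intro abs_sum_le c)
  moreover have "\<bar>?PQ\<bar> \<le> real (card {..<q}) * (real (card P) * (real (card {..<r}) * (real (card Q) * 1)))"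
    by (intro abs_sum_le g)
  moreover have "\<bar>?Q\<bar> \<le> real (card {..<r}) * (real (card Q) * (real (card ?X) * 1))"
    by (intro abs_sum_le g)
  moreover have "real (card ?X) = ?a + ?b" using fin by (simp add: card_copies)
  ultimately have "\<bar>?PP + ?PQ + ?Q\<bar> \<le> real q ^ 2 * c + ?a * ?b + ?b * (?a + ?b)"
    by (simp add: power2_eq_square algebra_simps)
  also have "\<dots> = real q ^ 2 * c + (?a + ?b) ^ 2 - ?a ^ 2"
    by (simp add: power2_eq_square algebra_simps)
  finally show ?thesis using eq by simp
qed

lemma copies_bounded_entry: "copies_bounded TYPE('t) 2
    (entry_norm :: 'p set \<Rightarrow> _) (entry_norm :: ('p \<times> nat + 'q \<times> nat) set \<Rightarrow> _)"
  unfolding copies_bounded_def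
proof (intro allI impI)
  fix P :: "'p set" and Q :: "'q set" and \<tau> :: "'p \<Rightarrow> 't" and \<rho> :: "'q \<Rightarrow> 't" and K :: "('t, 't) mat" and q r
  assume fin: "finite P" "finite Q" and K: "\<forall>s t. \<bar>K s t\<bar> \<le> 1"
  show "entry_norm (copies P q Q r) (copies P q Q r)
          (\<lambda>x y. K (copies_type \<tau> \<rho> x) (copies_type \<tau> \<rho> y))
        \<le> real q ^ 2 * entry_norm P P (\<lambda>x y. K (\<tau> x) (\<tau> y))
          + real (q * card P + r * card Q) ^ 2 - real (q * card P) ^ 2"
    unfolding entry_norm_def
    by (rule order_trans[OF abs_ge_self], rule double_sum_copies_le) (use fin K in \<open>auto simp: sum_nonneg\<close>)
qed

text \<open>A cut of the stack restricts, on each pair of copies of \<open>P\<close>, to a cut of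
  \<open>P\<close>. Setting the entries outside \<open>S \<times> T\<close> to zero makes the cut a
  full double sum, to which the block estimate applies.\<close>

lemma copies_bounded_cut: "copies_bounded TYPE('t) 2
    (cut_norm :: 'p set \<Rightarrow> _) (cut_norm :: ('p \<times> nat + 'q \<times> nat) set \<Rightarrow> _)"
  unfolding copies_bounded_def
proof (intro allI impI)
  fix P :: "'p set" and Q :: "'q set" and \<tau> :: "'p \<Rightarrow> 't" and \<rho> :: "'q \<Rightarrow> 't" and K :: "('t, 't) mat" and q r
  assume fin: "finite P" "finite Q" and K: "\<forall>s t. \<bar>K s t\<bar> \<le> 1"
  let ?X = "copies P q Q r" and ?\<sigma> = "copies_type \<tau> \<rho>"
  have finX: "finite ?X" using fin by simp
  show "cut_norm ?X ?X (\<lambda>x y. K (?\<sigma> x) (?\<sigma> y))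
        \<le> real q ^ 2 * cut_norm P P (\<lambda>x y. K (\<tau> x) (\<tau> y))
          + real (q * card P + r * card Q) ^ 2 - real (q * card P) ^ 2"
  proof (rule cut_norm_le[OF finX finX])
    fix S T assume ST: "S \<subseteq> ?X" "T \<subseteq> ?X"
    let ?g = "\<lambda>x y. if x \<in> S then if y \<in> T then K (?\<sigma> x) (?\<sigma> y) else 0 else 0"
    have cut: "\<bar>\<Sum>x\<in>P. \<Sum>y\<in>P. ?g (Inl (x, i)) (Inl (y, j))\<bar>
        \<le> cut_norm P P (\<lambda>x y. K (\<tau> x) (\<tau> y))" for i j
    proof -
      let ?S = "{x\<in>P. Inl (x, i) \<in> S}" and ?T = "{y\<in>P. Inl (y, j) \<in> T}"
      have "(\<Sum>x\<in>P. \<Sum>y\<in>P. ?g (Inl (x, i)) (Inl (y, j)))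
          = (\<Sum>x\<in>P. if Inl (x, i) \<in> S then \<Sum>y\<in>?T. K (\<tau> x) (\<tau> y) else 0)"
        using fin by (intro sum.cong) (auto simp: sum.inter_filter cong: if_cong)
      also have "\<dots> = (\<Sum>x\<in>?S. \<Sum>y\<in>?T. K (\<tau> x) (\<tau> y))"
        by (rule sum.inter_filter[OF fin(1), symmetric])
      finally show ?thesis using cut_norm_ge[OF fin(1,1), of ?S ?T] by simp
    qed
    have "(\<Sum>x\<in>S. \<Sum>y\<in>T. K (?\<sigma> x) (?\<sigma> y)) = (\<Sum>x\<in>?X. \<Sum>y\<in>?X. ?g x y)"
    proof -
      have restrict: "sum f A = (\<Sum>x\<in>?X. if x \<in> A then f x else 0)"
        if "A \<subseteq> ?X" for f :: "_ \<Rightarrow> real" and A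
        using sum.inter_restrict[OF finX, of f A] that by (simp add: Int_absorb1)
      have "(\<Sum>x\<in>S. \<Sum>y\<in>T. K (?\<sigma> x) (?\<sigma> y))
          = (\<Sum>x\<in>?X. if x \<in> S then \<Sum>y\<in>?X. if y \<in> T then K (?\<sigma> x) (?\<sigma> y) else 0 else 0)"
        by (simp only: restrict[OF ST(1)] restrict[OF ST(2)])
      also have "\<dots> = (\<Sum>x\<in>?X. \<Sum>y\<in>?X. ?g x y)" by (intro sum.cong) auto
      finally show ?thesis .
    qed
    also have "\<bar>\<dots>\<bar> \<le> real q ^ 2 * cut_norm P P (\<lambda>x y. K (\<tau> x) (\<tau> y))
        + real (q * card P + r * card Q) ^ 2 - real (q * card P) ^ 2"
      by (rule double_sum_copies_le[OF fin _ cut]) (use K in auto)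
    finally show "\<bar>\<Sum>x\<in>S. \<Sum>y\<in>T. K (?\<sigma> x) (?\<sigma> y)\<bar> \<le> \<dots>" .
  qed
qed

text \<open>Every added column has the type of an old one, so its column sum is controlled as well;
  for the operator norm an arbitrary extension would not do.\<close>

lemma copies_bounded_op: "copies_bounded TYPE('t) 1
    (op_norm1 :: 'p set \<Rightarrow> _) (op_norm1 :: ('p \<times> nat + 'q \<times> nat) set \<Rightarrow> _)"
  unfolding copies_bounded_def
proof (intro allI impI)
  fix P :: "'p set" and Q :: "'q set" and \<tau> :: "'p \<Rightarrow> 't" and \<rho> :: "'q \<Rightarrow> 't" and K :: "('t, 't) mat" and q r
  let ?X = "copies P q Q r" and ?\<sigma> = "copies_type \<tau> \<rho>"
  assume fin: "finite P" "finite Q" and ne: "P \<noteq> {}" "?X \<noteq> {}"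
    and sub: "\<rho> ` Q \<subseteq> \<tau> ` P" and K: "\<forall>s t. \<bar>K s t\<bar> \<le> 1"
  let ?M = "op_norm1 P P (\<lambda>x y. K (\<tau> x) (\<tau> y))"
  have finX: "finite ?X" using fin by simp
  have "(\<Sum>x\<in>?X. \<bar>K (?\<sigma> x) (?\<sigma> y)\<bar>) \<le> real q * ?M + real (r * card Q)" if "y \<in> ?X" for y
  proof -
    \<comment> \<open>Restricted to any copy of \<open>P\<close>, the column of \<open>y\<close> is
      the column of \<open>p\<close>, even when \<open>y\<close> comes from \<open>Q\<close>; the
      rows from \<open>Q\<close> add at most 1 each.\<close>
    have "?\<sigma> y \<in> \<tau> ` P" using that sub by auto
    then obtain p where p: "p \<in> P" "?\<sigma> y = \<tau> p" by blast
    have "(\<Sum>x\<in>?X. \<bar>K (?\<sigma> x) (?\<sigma> y)\<bar>)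
        = real q * (\<Sum>x\<in>P. \<bar>K (\<tau> x) (\<tau> p)\<bar>) + real r * (\<Sum>x\<in>Q. \<bar>K (\<rho> x) (\<tau> p)\<bar>)"
      unfolding p(2) by (simp add: sum_copies[OF fin])
    also have "\<dots> \<le> real q * ?M + real r * (real (card Q) * 1)"
    proof (intro add_mono mult_left_mono)
      show "(\<Sum>x\<in>P. \<bar>K (\<tau> x) (\<tau> p)\<bar>) \<le> ?M"
        using fin ne p by (subst op_norm1_eq_Max) (auto intro!: Max_ge)
      show "(\<Sum>x\<in>Q. \<bar>K (\<rho> x) (\<tau> p)\<bar>) \<le> real (card Q) * 1"
        using K by (intro sum_bounded_above) auto
    qed auto
    finally show ?thesis by simp
  qed
  then have "op_norm1 ?X ?X (\<lambda>x y. K (?\<sigma> x) (?\<sigma> y)) \<le> real q * ?M + real (r * card Q)"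
    using finX ne by (subst op_norm1_eq_Max) (auto simp del: Plus_eq_empty_conv)
  then show "op_norm1 ?X ?X (\<lambda>x y. K (?\<sigma> x) (?\<sigma> y))
      \<le> real q ^ 1 * ?M + real (q * card P + r * card Q) ^ 1 - real (q * card P) ^ 1" by simp
qed

subsection \<open>Distances of blow-ups\<close>

text \<open>The kernel on types from which the difference matrix of every bijection of blow-ups is
  pulled back; it is the same at all levels.\<close>

definition overlay_mat :: "'a graph \<Rightarrow> 'b graph \<Rightarrow> ('a \<times> 'b, 'a \<times> 'b) mat" where
  "overlay_mat G H s t = adj_mat G (fst s) (fst t) - adj_mat H (snd s) (snd t)"

lemma abs_overlay_mat_le: "\<bar>overlay_mat G H s t\<bar> \<le> 1"
  by (simp add: overlay_mat_def adj_mat_def)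

lemma verts_blow_up [simp]: "verts (blow_up G k) = verts G \<times> {1..k}"
  by (simp add: blow_up_def)

lemma adj_mat_blow_up:
  assumes "p \<in> verts (blow_up G k)" "p' \<in> verts (blow_up G k)"
  shows "adj_mat (blow_up G k) p p' = adj_mat G (fst p) (fst p')"
proof -
  have "{p, p'} \<in> edges (blow_up G k) \<longleftrightarrow> {fst p, fst p'} \<in> edges G"
    using assms by (cases p; cases p') (auto simp: blow_up_def doubleton_eq_iff insert_commute)
  then show ?thesis by (simp add: adj_mat_def)
qed

lemma finite_bijections: "finite V \<Longrightarrow> finite W \<Longrightarrow> finite (bijections V W)"
  unfolding bijections_def by (rule finite_subset[OF _ finite_PiE[of V "\<lambda>_. W"]]) auto

lemma restrict_in_bijections:
  assumes "bij_betw \<pi> V W"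
  shows "restrict \<pi> V \<in> bijections V W"
  using assms bij_betw_apply[OF assms]
  by (auto simp: bijections_def cong: bij_betw_cong)

text \<open>Pulling the difference matrix back along \<open>\<pi> \<circ> g\<close> allows any index
  set \<open>P\<close> of the right size, in particular a stack of copies, to replace the vertices
  of \<open>H\<close>.\<close>

lemma graph_dist_le:
  assumes "finite (verts G)" "finite (verts H)" "bij_betw \<pi> (verts G) (verts H)"
    and "P \<noteq> {}" "finite P" "bij_betw g P (verts G)" and re: "reindexable nW nP"
  shows "graph_dist nW G H
    \<le> nP P P (\<lambda>x y. adj_mat G (g x) (g y) - adj_mat H (\<pi> (g x)) (\<pi> (g y)))"
proof -
  let ?\<pi> = "restrict \<pi> (verts G)"
  let ?D = "\<lambda>w w'. permute_mat (verts G) ?\<pi> (adj_mat G) w w' - adj_mat H w w'"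
  have mem: "?\<pi> \<in> bijections (verts G) (verts H)" by (rule restrict_in_bijections[OF assms(3)])
  then have "graph_dist nW G H \<le> nW (verts H) (verts H) ?D"
    unfolding graph_dist_def using assms by (intro Min_le) (auto simp: finite_bijections)
  also have "\<dots> = nP P P (\<lambda>x y. adj_mat G (g x) (g y) - adj_mat H (\<pi> (g x)) (\<pi> (g y)))"
  proof -
    have "inj_on ?\<pi> (verts G)" using mem by (simp add: bijections_def bij_betw_def)
    then have "inv_into (verts G) ?\<pi> (\<pi> (g x)) = g x" if "x \<in> P" for x
      using bij_betw_apply[OF assms(6) that] by (metis inv_into_f_f restrict_apply')
    moreover have "bij_betw (\<pi> \<circ> g) P (verts H)" using assms bij_betw_trans by blast
    ultimately show ?thesis using re[unfolded reindexable_def, rule_format, of P "\<pi> \<circ> g" "verts H"] assms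
      by (simp add: permute_mat_def)
  qed
  finally show ?thesis .
qed

text \<open>Equal orders make the set of bijections nonempty, so the minimum is a genuine one.
  Pulled back to the vertices of \<open>G\<close>, the matrix no longer contains the inverse of
  \<open>\<pi>\<close>.\<close>

lemma graph_dist_attained:
  assumes "finite (verts G)" "verts G \<noteq> {}" "finite (verts H)" "card (verts G) = card (verts H)"
    and re: "reindexable nW nV"
  obtains \<pi> where "bij_betw \<pi> (verts G) (verts H)"
    and "graph_dist nW G H
      = nV (verts G) (verts G) (\<lambda>x y. adj_mat G x y - adj_mat H (\<pi> x) (\<pi> y))"
proof -
  let ?D = "\<lambda>\<pi> w w'. permute_mat (verts G) \<pi> (adj_mat G) w w' - adj_mat H w w'"
  let ?B = "bijections (verts G) (verts H)"
  obtain \<pi>0 where "bij_betw \<pi>0 (verts G) (verts H)"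
    using assms finite_same_card_bij by blast
  then have "?B \<noteq> {}" using restrict_in_bijections by blast
  then have "graph_dist nW G H \<in> (\<lambda>\<pi>. nW (verts H) (verts H) (?D \<pi>)) ` ?B"
    unfolding graph_dist_def using assms by (intro Min_in) (auto simp: finite_bijections)
  then obtain \<pi> where \<pi>: "\<pi> \<in> ?B" "graph_dist nW G H = nW (verts H) (verts H) (?D \<pi>)" by blast
  then have bij: "bij_betw \<pi> (verts G) (verts H)" by (simp add: bijections_def)
  then have "inv_into (verts G) \<pi> (\<pi> x) = x" if "x \<in> verts G" for x
    using that by (simp add: bij_betw_inv_into_left)
  then have "nW (verts H) (verts H) (?D \<pi>)
      = nV (verts G) (verts G) (\<lambda>x y. adj_mat G x y - adj_mat H (\<pi> x) (\<pi> y))"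
    using re[unfolded reindexable_def, rule_format, of "verts G" \<pi> "verts H"] assms bij
    by (simp add: permute_mat_def)
  with \<pi> bij that show thesis by simp
qed

text \<open>Numbering the fibres of the two projections of \<open>\<tau>\<close> gives bijections
  \<open>g\<close> and \<open>h\<close> from \<open>P\<close> onto the two vertex sets. The
  bijection sending \<open>g p\<close> to \<open>h p\<close> then matches exactly the types
  prescribed by \<open>\<tau>\<close>.\<close>

lemma graph_dist_blow_up_le:
  assumes fin: "finite (verts G)" "finite (verts H)" and "P \<noteq> {}"
    and ov: "overlay (verts G) (verts H) a b P \<tau>" and re: "reindexable nW nP" "reindexable nP nP"
  shows "graph_dist nW (blow_up G a) (blow_up H b)
    \<le> nP P P (\<lambda>x y. overlay_mat G H (\<tau> x) (\<tau> y))"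
proof -
  have ov': "finite P" "\<tau> \<in> P \<rightarrow> verts G \<times> verts H"
    "\<And>v. v \<in> verts G \<Longrightarrow> card {p\<in>P. fst (\<tau> p) = v} = a"
    "\<And>w. w \<in> verts H \<Longrightarrow> card {p\<in>P. snd (\<tau> p) = w} = b"
    using ov by (auto simp: overlay_def)
  have "(\<lambda>p. fst (\<tau> p)) \<in> P \<rightarrow> verts G" "(\<lambda>p. snd (\<tau> p)) \<in> P \<rightarrow> verts H"
    using ov'(2) by (auto simp: Pi_iff mem_Times_iff)
  from bij_betw_fibres[OF ov'(1) this(1) ov'(3)] bij_betw_fibres[OF ov'(1) this(2) ov'(4)]
  obtain g h where g: "bij_betw g P (verts (blow_up G a))" "\<And>p. p \<in> P \<Longrightarrow> fst (g p) = fst (\<tau> p)"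
    and h: "bij_betw h P (verts (blow_up H b))" "\<And>p. p \<in> P \<Longrightarrow> fst (h p) = snd (\<tau> p)"
    by (metis verts_blow_up)
  let ?\<pi> = "h \<circ> inv_into P g"
  have \<pi>: "bij_betw ?\<pi> (verts (blow_up G a)) (verts (blow_up H b))"
    using bij_betw_trans[OF bij_betw_inv_into[OF g(1)] h(1)] .
  have \<pi>g: "?\<pi> (g p) = h p" if "p \<in> P" for p
    using bij_betw_inv_into_left[OF g(1) that] by simp
  have "graph_dist nW (blow_up G a) (blow_up H b) \<le> nP P P (\<lambda>x y. adj_mat (blow_up G a) (g x) (g y)
      - adj_mat (blow_up H b) (?\<pi> (g x)) (?\<pi> (g y)))"
    by (rule graph_dist_le[OF _ _ \<pi> \<open>P \<noteq> {}\<close> ov'(1) g(1) re(1)]) (use fin in auto)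
  also have "\<dots> = nP P P (\<lambda>x y. overlay_mat G H (\<tau> x) (\<tau> y))"
  proof (rule re(2)[unfolded reindexable_def, rule_format])
    fix x y assume xy: "x \<in> P" "y \<in> P"
    then show "overlay_mat G H (\<tau> x) (\<tau> y) = adj_mat (blow_up G a) (g (id x)) (g (id y))
      - adj_mat (blow_up H b) (?\<pi> (g (id x))) (?\<pi> (g (id y)))"
      using bij_betw_apply[OF g(1)] bij_betw_apply[OF h(1)] \<pi>g g(2) h(2)
      by (simp add: overlay_mat_def adj_mat_blow_up del: verts_blow_up o_apply)
  qed (use ov' \<open>P \<noteq> {}\<close> bij_betw_id in \<open>auto simp: id_def\<close>)
  finally show ?thesis .
qed

lemma graph_dist_blow_up_attained:
  fixes G :: "'a graph" and H :: "'b graph"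
    and nV :: "('a \<times> nat) set \<Rightarrow> ('a \<times> nat) set \<Rightarrow> ('a \<times> nat, 'a \<times> nat) mat \<Rightarrow> real"
  assumes fin: "finite (verts G)" "finite (verts H)" and "verts G \<noteq> {}" "a \<ge> 1"
    and card: "card (verts G) * a = card (verts H) * b"
    and re: "reindexable nW nV" "reindexable nV nV"
  obtains \<tau> where "overlay (verts G) (verts H) a b (verts G \<times> {1..a}) \<tau>"
    and "graph_dist nW (blow_up G a) (blow_up H b)
      = nV (verts G \<times> {1..a}) (verts G \<times> {1..a}) (\<lambda>x y. overlay_mat G H (\<tau> x) (\<tau> y))"
proof -
  obtain \<pi> where \<pi>: "bij_betw \<pi> (verts (blow_up G a)) (verts (blow_up H b))"
    and eq: "graph_dist nW (blow_up G a) (blow_up H b) = nV (verts (blow_up G a)) (verts (blow_up G a))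
      (\<lambda>x y. adj_mat (blow_up G a) x y - adj_mat (blow_up H b) (\<pi> x) (\<pi> y))"
    by (rule graph_dist_attained[OF _ _ _ _ re(1), of "blow_up G a" "blow_up H b"])
      (use assms in \<open>auto simp: card_cartesian_product\<close>)
  let ?\<tau> = "\<lambda>p. (fst p, fst (\<pi> p))"
  note eq
  also have "nV (verts (blow_up G a)) (verts (blow_up G a))
      (\<lambda>x y. adj_mat (blow_up G a) x y - adj_mat (blow_up H b) (\<pi> x) (\<pi> y))
    = nV (verts (blow_up G a)) (verts (blow_up G a)) (\<lambda>x y. overlay_mat G H (?\<tau> x) (?\<tau> y))"
  proof (rule re(2)[unfolded reindexable_def, rule_format])
    fix x y assume xy: "x \<in> verts (blow_up G a)" "y \<in> verts (blow_up G a)"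
    then show "overlay_mat G H (?\<tau> x) (?\<tau> y) = adj_mat (blow_up G a) (id x) (id y)
        - adj_mat (blow_up H b) (\<pi> (id x)) (\<pi> (id y))"
      using bij_betw_apply[OF \<pi>] by (simp add: overlay_mat_def adj_mat_blow_up del: verts_blow_up)
  qed (use assms bij_betw_id in \<open>auto simp: id_def\<close>)
  finally show thesis using that overlay_of_bij[OF fin \<pi>[unfolded verts_blow_up]]
    by simp
qed

subsection \<open>Convergence\<close>

text \<open>Fix \<open>l\<close> with \<open>f l\<close> close to the infimum and divide a large
  \<open>k\<close> by \<open>l\<close>. The remainder is below \<open>l\<close>, so the excess of
  \<open>f k\<close> over \<open>f l\<close> is at most \<open>1 - (1 - l/k) ^ d\<close>, which
  tends to 0.\<close>

lemma convergent_if_almost_decreasing: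
  fixes f :: "nat \<Rightarrow> real"
  assumes nonneg: "\<And>l. l \<ge> 1 \<Longrightarrow> f l \<ge> 0"
    and step: "\<And>l q r. l \<ge> 1 \<Longrightarrow> q * l + r \<ge> 1 \<Longrightarrow>
      f (q * l + r) \<le> f l + 1 - (real (q * l) / real (q * l + r)) ^ d"
  shows "convergent f"
proof -
  let ?L = "Inf (f ` {1..})"
  have bdd: "bdd_below (f ` {1..})" using nonneg by (auto intro!: bdd_belowI[of _ 0])
  have "f \<longlonglongrightarrow> ?L"
  proof (rule LIMSEQ_I)
    fix e :: real assume "e > 0"
    have "\<exists>y\<in>f ` {1..}. y < ?L + e / 2"
      by (rule cInf_lessD) (use \<open>e > 0\<close> in auto)
    then obtain l where l: "l \<ge> 1" "f l < ?L + e / 2" by auto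
    have "(\<lambda>k. real l / real k) \<longlonglongrightarrow> 0" by (rule lim_const_over_n)
    then have "(\<lambda>k. (1 - real l / real k) ^ d) \<longlonglongrightarrow> (1 - 0) ^ d" by (intro tendsto_intros)
    then have "eventually (\<lambda>k. (1 - real l / real k) ^ d > 1 - e / 2) sequentially"
      using \<open>e > 0\<close> by (intro order_tendstoD(1)) auto
    then obtain k0 where k0: "\<And>k. k \<ge> k0 \<Longrightarrow> (1 - real l / real k) ^ d > 1 - e / 2"
      by (auto simp: eventually_sequentially)
    have "norm (f k - ?L) < e" if k: "k \<ge> max l k0" for k
    proof -
      have "k \<ge> 1" using k l by simp
      have dm: "k div l * l + k mod l = k" by simp
      have "k mod l < l" using l by simp
      then have "real k - real l \<le> real (k div l * l)" using dm by linarith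
      then have "(real k - real l) / real k \<le> real (k div l * l) / real k"
        by (rule divide_right_mono) simp
      then have "1 - real l / real k \<le> real (k div l * l) / real k"
        using \<open>k \<ge> 1\<close> by (simp add: diff_divide_distrib)
      moreover have "0 \<le> 1 - real l / real k" using k \<open>k \<ge> 1\<close> by simp
      ultimately have "(1 - real l / real k) ^ d \<le> (real (k div l * l) / real k) ^ d"
        by (rule power_mono)
      moreover have "f k \<le> f l + 1 - (real (k div l * l) / real k) ^ d"
        using step[of l "k div l" "k mod l"] l \<open>k \<ge> 1\<close> unfolding dm by simp
      ultimately have "f k < ?L + e" using k0[of k] k l by simp
      moreover have "?L \<le> f k" using \<open>k \<ge> 1\<close> bdd by (intro cInf_lower) auto
      ultimately show ?thesis by simp
    qed
    then show "\<exists>k0. \<forall>k\<ge>k0. norm (f k - ?L) < e" by blast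
  qed
  then show ?thesis by (rule convergentI)
qed

text \<open>\<open>nW\<close>, \<open>nV\<close> and \<open>nX\<close> are one norm at three types:
  on the blow-up of \<open>H\<close>, on that of \<open>G\<close>, and on a stack of copies. The
  same \<open>d\<close> governs growth and normalisation, which makes the normalised step estimate
  independent of the graphs.\<close>

lemma convergent_graph_dist:
  fixes G :: "'a graph" and H :: "'b graph"
    and nV :: "('a \<times> nat) set \<Rightarrow> ('a \<times> nat) set \<Rightarrow> ('a \<times> nat, 'a \<times> nat) mat \<Rightarrow> real"
    and nX :: "(('a \<times> nat) \<times> nat + ('a \<times> nat) \<times> nat) set \<Rightarrow>
      (('a \<times> nat) \<times> nat + ('a \<times> nat) \<times> nat) set \<Rightarrow>
      (('a \<times> nat) \<times> nat + ('a \<times> nat) \<times> nat, ('a \<times> nat) \<times> nat + ('a \<times> nat) \<times> nat) mat \<Rightarrow> real"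
  assumes fin: "finite (verts G)" "finite (verts H)" and ne: "verts G \<noteq> {}" "verts H \<noteq> {}"
    and re: "reindexable nW nV" "reindexable nV nV" "reindexable nW nX" "reindexable nX nX"
    and bound: "copies_bounded TYPE('a \<times> 'b) d nV nX"
    and nonneg: "\<And>P B. finite P \<Longrightarrow> P \<noteq> {} \<Longrightarrow> nV P P B \<ge> 0"
  shows "convergent (\<lambda>l. graph_dist nW (blow_up G (l * card (verts H))) (blow_up H (l * card (verts G)))
    / real (graph_order (blow_up G (l * card (verts H)))) ^ d)"
proof -
  let ?m = "card (verts G)" and ?n = "card (verts H)"
  let ?F = "\<lambda>l. graph_dist nW (blow_up G (l * ?n)) (blow_up H (l * ?m))"
  let ?P = "\<lambda>l. verts G \<times> {1..l * ?n}"
  let ?K = "overlay_mat G H"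
  have pos: "?m > 0" "?n > 0" using fin ne by (auto simp: card_gt_0_iff)
  have order: "graph_order (blow_up G (l * ?n)) = l * (?m * ?n)" for l
    by (simp add: graph_order_def card_cartesian_product)
  have attained: "\<exists>\<tau>. overlay (verts G) (verts H) (l * ?n) (l * ?m) (?P l) \<tau> \<and>
      ?F l = nV (?P l) (?P l) (\<lambda>x y. ?K (\<tau> x) (\<tau> y))" if "l \<ge> 1" for l
    by (rule graph_dist_blow_up_attained[OF fin ne(1) _ _ re(1,2), of "l * ?n" "l * ?m"])
      (use that pos in auto)
  have "convergent (\<lambda>l. ?F l / real (l * (?m * ?n)) ^ d)"
  proof (rule convergent_if_almost_decreasing)
    fix l :: nat assume "l \<ge> 1"
    with attained[OF this] obtain \<tau> where "?F l = nV (?P l) (?P l) (\<lambda>x y. ?K (\<tau> x) (\<tau> y))" by blast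
    moreover have "?P l \<noteq> {}" using \<open>l \<ge> 1\<close> pos ne by auto
    ultimately show "?F l / real (l * (?m * ?n)) ^ d \<ge> 0" using nonneg fin by simp
  next
    fix l q r :: nat assume l: "l \<ge> 1" and k: "q * l + r \<ge> 1"
    let ?k = "q * l + r" and ?s = "?m * ?n"
    from attained[OF l] obtain \<tau> where ov: "overlay (verts G) (verts H) (l * ?n) (l * ?m) (?P l) \<tau>"
      and F: "?F l = nV (?P l) (?P l) (\<lambda>x y. ?K (\<tau> x) (\<tau> y))" by blast
    \<comment> \<open>The level-one overlay makes levels that are not multiples of \<open>l\<close>
      reachable.\<close>
    obtain \<rho> where ov': "overlay (verts G) (verts H) ?n ?m (verts G \<times> {1..?n}) \<rho>"
      and sub: "\<rho> ` (verts G \<times> {1..?n}) \<subseteq> \<tau> ` ?P l"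
      using overlay_round[OF ov l fin] .
    let ?X = "copies (?P l) q (verts G \<times> {1..?n}) r" and ?\<sigma> = "copies_type \<tau> \<rho>"
    have cardX: "q * card (?P l) + r * card (verts G \<times> {1..?n}) = ?k * ?s"
      by (simp add: card_cartesian_product algebra_simps)
    then have "card ?X > 0" using fin k pos by (subst card_copies) auto
    then have X: "?X \<noteq> {}" by (metis card.empty less_irrefl)
    have P: "?P l \<noteq> {}" using l pos ne by auto
    have "overlay (verts G) (verts H) (?k * ?n) (?k * ?m) ?X ?\<sigma>"
      using overlay_copies[OF ov ov', of q r] by (simp add: algebra_simps)
    then have "?F ?k \<le> nX ?X ?X (\<lambda>x y. ?K (?\<sigma> x) (?\<sigma> y))"
      by (rule graph_dist_blow_up_le[OF fin X _ re(3,4)])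
    also have "\<dots> \<le> real q ^ d * ?F l + real (?k * ?s) ^ d - real (q * card (?P l)) ^ d"
      unfolding F cardX[symmetric]
      by (rule bound[unfolded copies_bounded_def, rule_format])
        (use fin P X sub in \<open>auto simp: abs_overlay_mat_le simp del: Plus_eq_empty_conv\<close>)
    also have "q * card (?P l) = q * l * ?s" by (simp add: card_cartesian_product)
    finally have le: "?F ?k \<le> real q ^ d * ?F l + real (?k * ?s) ^ d - real (q * l * ?s) ^ d" .
    have "l > 0" "?k > 0" using l k by linarith+
    have ratio: "real (q * l) / real ?k \<le> 1"
      using \<open>?k > 0\<close> by (subst divide_le_eq_1_pos) (simp_all only: of_nat_0_less_iff of_nat_le_iff le_add1)
    \<comment> \<open>Expresses the main term at level \<open>?k\<close> through the normalised
      distance at level \<open>l\<close>; the factor left over is the power of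
      \<open>q * l / ?k\<close> that also occurs in the error.\<close>
    have rescale: "Q ^ d * F / (K * S) ^ d = (Q * L / K) ^ d * (F / (L * S) ^ d)"
      if "L > 0" "S > 0" "K > 0" for Q F K L S :: real
      using that by (simp add: power_mult_distrib power_divide)
    have F0: "?F l / real (l * ?s) ^ d \<ge> 0" using F nonneg fin P by simp
    have ks: "real (?k * ?s) > 0" using \<open>?k > 0\<close> pos by (simp only: of_nat_0_less_iff nat_0_less_mult_iff)
    have "?F ?k / real (?k * ?s) ^ d
        \<le> (real q ^ d * ?F l + real (?k * ?s) ^ d - real (q * l * ?s) ^ d) / real (?k * ?s) ^ d"
      using le ks by (intro divide_right_mono) auto
    also have "\<dots> = real q ^ d * ?F l / real (?k * ?s) ^ d + 1 - (real (q * l * ?s) / real (?k * ?s)) ^ d"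
      using divide_self[OF power_not_zero[OF less_imp_neq[OF ks, symmetric]]]
      by (simp only: add_divide_distrib diff_divide_distrib power_divide)
    also have "real (q * l * ?s) / real (?k * ?s) = real (q * l) / real ?k"
      using pos by simp
    also have "real q ^ d * ?F l / real (?k * ?s) ^ d
        = (real (q * l) / real ?k) ^ d * (?F l / real (l * ?s) ^ d)"
      unfolding of_nat_mult[of ?k ?s] of_nat_mult[of l ?s] of_nat_mult[of q l]
      by (rule rescale) (use \<open>l > 0\<close> \<open>?k > 0\<close> pos in \<open>simp_all only: of_nat_0_less_iff nat_0_less_mult_iff\<close>)
    also have "\<dots> \<le> 1 * (?F l / real (l * ?s) ^ d)"
      by (rule mult_right_mono[OF power_le_one[OF _ ratio] F0]) (rule divide_nonneg_nonneg[OF of_nat_0_le_iff of_nat_0_le_iff])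
    finally show "?F ?k / real (?k * ?s) ^ d
        \<le> ?F l / real (l * ?s) ^ d + 1 - (real (q * l) / real ?k) ^ d" by simp
  qed
  then show ?thesis by (simp only: order)
qed

theorem theorem3p4:
  fixes G :: "'a graph" and H :: "'b graph" and m n :: nat
  assumes "simple_graph G" and "simple_graph H"
    and "graph_order G = m" and "graph_order H = n"
    and "m \<ge> 1" and "n \<ge> 1"
  shows "\<forall>\<delta> \<in> {ndist_entry, ndist_op, ndist_cut}.
           convergent (\<lambda>l. \<delta> (blow_up G (l * n)) (blow_up H (l * m)))"
proof -
  have fin: "finite (verts G)" "finite (verts H)"
    using assms by (auto simp: simple_graph_def)
  have ne: "verts G \<noteq> {}" "verts H \<noteq> {}"
    using assms by (auto simp: graph_order_def)
  have mn: "m = card (verts G)" "n = card (verts H)"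
    using assms by (auto simp: graph_order_def)
  have "convergent (\<lambda>l. ndist_entry (blow_up G (l * n)) (blow_up H (l * m)))"
    unfolding ndist_entry_def mn
    by (rule convergent_graph_dist[OF fin ne reindexable_entry reindexable_entry reindexable_entry
          reindexable_entry copies_bounded_entry]) (simp add: entry_norm_def sum_nonneg)
  moreover have "convergent (\<lambda>l. ndist_cut (blow_up G (l * n)) (blow_up H (l * m)))"
    unfolding ndist_cut_def mn
    by (rule convergent_graph_dist[OF fin ne reindexable_cut reindexable_cut reindexable_cut
          reindexable_cut copies_bounded_cut])
      (rule order_trans[OF abs_ge_zero cut_norm_ge[OF _ _ empty_subsetI empty_subsetI]])
  moreover have "op_norm1 P P B \<ge> 0" if "finite P" "P \<noteq> {}" for P :: "('a \<times> nat) set" and B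
    using that by (auto simp: op_norm1_eq_Max Max_ge_iff sum_nonneg)
  then have "convergent (\<lambda>l. ndist_op (blow_up G (l * n)) (blow_up H (l * m)))"
    unfolding ndist_op_def mn
    using convergent_graph_dist[OF fin ne reindexable_op reindexable_op reindexable_op
          reindexable_op copies_bounded_op] by simp
  ultimately show ?thesis by simp
qed

end
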